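(* Let $0<\tau\leq\frac{1}{1+2\sqrt{2+\sqrt{5}}}$. Then there exists a sequence $(\alpha_i)_{i=1}^{\infty}$ such that (i) $\lim_{i\rightarrow\infty}\alpha_i=\tau$, and (ii) for all $i$, there exists $\eta_i>0$ such that $N_{\alpha_i}(d)\geq(1+\eta_i)d$.
   Context: A system of lines through the origin in $d$-dimensional Euclidean space $\mathbb{R}^d$ is called equiangular if the angle between any pair of lines is the same. $N_{\alpha}(d)$ denotes the maximum number of lines in a system of equiangular lines in $\mathbb{R}^d$ with common angle $\arccos\alpha$. *)

theory Defs
  imports Complex_Main "Jordan_Normal_Form.Matrix"
begin

text \<open>The dimension \<open>d\<close> varies inside the theorem, so Euclidean space is the set
  \<^term>\<open>carrier_vec d\<close> of real vectors of length \<open>d\<close>.\<close>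

definition vec_norm :: "real vec \<Rightarrow> real" where
  "vec_norm v = sqrt (v \<bullet> v)"

definition vec_angle :: "real vec \<Rightarrow> real vec \<Rightarrow> real" where
  "vec_angle u v = arccos ((u \<bullet> v) / (vec_norm u * vec_norm v))"

definition origin_lines :: "nat \<Rightarrow> real vec set set" where
  "origin_lines d = {L. \<exists>v \<in> carrier_vec d. v \<noteq> 0\<^sub>v d \<and> L = range (\<lambda>c. c \<cdot>\<^sub>v v)}"

text \<open>Direction vectors of two lines enclose one of two supplementary angles; the angle between
  the lines is the smaller one, so it lies between 0 and \<open>\<pi>/2\<close>.\<close>

definition line_angle :: "nat \<Rightarrow> real vec set \<Rightarrow> real vec set \<Rightarrow> real" where
  "line_angle d L M = Inf {vec_angle u v | u v. u \<in> L - {0\<^sub>v d} \<and> v \<in> M - {0\<^sub>v d}}"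

definition equiangular :: "nat \<Rightarrow> real \<Rightarrow> real vec set set \<Rightarrow> bool" where
  "equiangular d \<theta> S \<longleftrightarrow> S \<subseteq> origin_lines d \<and>
     (\<forall>L \<in> S. \<forall>M \<in> S. L \<noteq> M \<longrightarrow> line_angle d L M = \<theta>)"

text \<open>For \<open>0 \<le> \<alpha> < 1\<close> the cardinalities below are bounded in terms of \<open>d\<close>
  (Gerzon's bound is \<open>d (d + 1) / 2\<close>), so the maximum exists.\<close>

definition N :: "real \<Rightarrow> nat \<Rightarrow> nat" where
  "N \<alpha> d = Max {card S | S. finite S \<and> equiangular d (arccos \<alpha>) S}"

end

theory Submission
  imports Defs
begin

text \<open>The substitution \<open>\<alpha> = 1 / (1 + 2 * x)\<close>, that is \<open>x = (1 - \<alpha>) / (2 * \<alpha>)\<close>, turns the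
  problem into one about graph eigenvalues. Let \<open>T\<close> be a tree with \<open>e \<ge> 1\<close> edges and adjacency matrix
  \<open>A\<close>, and suppose that \<open>x\<close> is an eigenvalue of \<open>A\<close> with a positive eigenvector \<open>f\<close>. Then
  \<open>x * I - A\<close> is a sum of \<open>e\<close> squares, one for each edge \<open>uv\<close>, namely the quadratic form
  \<open>(sqrt (f v / f u) * X\<^sub>u - sqrt (f u / f v) * X\<^sub>v)\<^sup>2\<close>. So the \<open>e + 1\<close> vertices have vectors in
  dimension \<open>e\<close> with Gram matrix \<open>x * I - A\<close>. Take \<open>m\<close> orthogonal copies of them, scale by
  \<open>sqrt (2 * \<alpha>)\<close>, and add one common coordinate \<open>sqrt \<alpha>\<close>. The result consists of unit vectors with pairwise scalar
  products \<open>\<plusminus>\<alpha>\<close>, hence of \<open>m * (e + 1)\<close> equiangular lines in dimension \<open>m * e + 1\<close>. As \<open>d\<close> grows,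
  the number of lines exceeds \<open>(1 + \<eta>) * d\<close> for every fixed \<open>\<eta> < 1 / e\<close>
  (\<open>graph_vectors_linear_gain\<close> takes \<open>\<eta> = 1 / (2 * e)\<close>). That \<^const>\<open>N\<close> is at least the size of this
  system requires the sizes of equiangular systems to be bounded, because a \<open>Max\<close> over an
  infinite set carries no information; this is \<open>equiangular_card_bounded\<close>.

  The bound on \<open>\<tau>\<close> says that the corresponding \<open>x\<close> is at least \<open>sqrt (2 + sqrt 5)\<close>. It remains
  to see that the numbers \<open>x\<close> as above are dense beyond this point, a fact due to Shearer
  (\<open>dense_linear_gain\<close>). Caterpillars suffice: paths whose \<open>i\<close>-th vertex carries \<open>n i\<close>
  leaves. The equation for an eigenvector fixes the ratio of its values at consecutive path
  vertices: \<open>r\<^sub>0 = x - n 0 / x\<close> and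
  \<open>r\<^sub>i\<^sub>+\<^sub>1 = x - 1 / r\<^sub>i - n (i + 1) / x\<close>. If the ratios stay positive until one of them vanishes, the
  eigenvector is positive and the path stops there. Let \<open>0 < a < b\<close> and \<open>b > sqrt (2 + sqrt 5)\<close>. Choose the \<open>n i\<close> greedily, as large as possible
  while the ratios at \<open>x = b\<close> stay above the smaller fixed point \<open>c\<close> of \<open>t \<mapsto> b - 1 / t\<close>. The
  heart of the proof is that the ratios at \<open>x = a\<close> for the same \<open>n\<close> cannot all be
  positive (\<open>spine_ratio_not_all_pos\<close>); the intermediate value theorem then yields a zero between
  \<open>a\<close> and \<open>b\<close>.

  To compare the two sequences, use the coordinate \<open>w t = (t - c) / (1 / c - t)\<close> between the two
  fixed points \<open>c\<close> and \<open>1 / c\<close>. The map \<open>t \<mapsto> b - 1 / t\<close> multiplies \<open>w\<close> by a constant and so preserves the quotient of the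
  two \<open>w\<close>-values. Subtracting the same leaf term from both ratios does not decrease the quotient as long as they
  lie low enough (\<open>cross_ratio_shift\<close>), and what ensures this is exactly \<open>c ^ 4 + c\<^sup>2 \<le> 1\<close>, equivalently
  \<open>b \<ge> sqrt (2 + sqrt 5)\<close> (the golden ratio enters here). Finally the difference \<open>b - a\<close> enlarges
  the quotient by a fixed factor in each step, although the quotient is bounded.\<close>

section \<open>The angle between two lines\<close>

lemma self_scalar_prod_ge_entry_square:
  fixes v :: "real vec"
  assumes "i < dim_vec v"
  shows "(v $ i)\<^sup>2 \<le> v \<bullet> v"
  using assms unfolding scalar_prod_def
  by (auto simp: power2_eq_square intro!: member_le_sum)

lemma self_scalar_prod_pos:
  fixes v :: "real vec"
  assumes "v \<in> carrier_vec d" "v \<noteq> 0\<^sub>v d"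
  shows "v \<bullet> v > 0"
proof -
  obtain i where i: "i < d" "v $ i \<noteq> 0" using assms by (metis eq_vecI carrier_vecD index_zero_vec)
  then have "0 < (v $ i)\<^sup>2" by simp
  also have "\<dots> \<le> v \<bullet> v" using i assms by (intro self_scalar_prod_ge_entry_square) auto
  finally show ?thesis .
qed

lemma unit_scalar_prod_le_one:
  fixes u v :: "real vec"
  assumes c: "u \<in> carrier_vec d" "v \<in> carrier_vec d" and 1: "u \<bullet> u = 1" "v \<bullet> v = 1"
  shows "\<bar>u \<bullet> v\<bar> \<le> 1"
proof -
  have nn: "w \<bullet> w \<ge> 0" for w :: "real vec"
    unfolding scalar_prod_def by (intro sum_nonneg) auto
  have "(u - v) \<bullet> (u - v) = 2 - 2 * (u \<bullet> v)"
    using c 1 comm_scalar_prod[OF c]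
    by (simp add: minus_scalar_prod_distrib[where n=d] scalar_prod_minus_distrib[where n=d])
  moreover have "(u + v) \<bullet> (u + v) = 2 + 2 * (u \<bullet> v)"
    using c 1 comm_scalar_prod[OF c]
    by (simp add: add_scalar_prod_distrib[where n=d] scalar_prod_add_distrib[where n=d])
  ultimately show ?thesis using nn[of "u - v"] nn[of "u + v"] by linarith
qed

text \<open>The scalars of the two spanning vectors matter only through their signs, so the infimum runs over
  the two values \<open>arccos (\<plusminus>(u \<bullet> v))\<close> and is attained.\<close>

lemma line_angle_unit_vectors:
  fixes u v :: "real vec"
  assumes c: "u \<in> carrier_vec d" "v \<in> carrier_vec d" and 1: "u \<bullet> u = 1" "v \<bullet> v = 1"
  shows "line_angle d (range (\<lambda>c. c \<cdot>\<^sub>v u)) (range (\<lambda>c. c \<cdot>\<^sub>v v)) = arccos \<bar>u \<bullet> v\<bar>"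
proof -
  let ?A = "{vec_angle x y |x y. x \<in> range (\<lambda>c. c \<cdot>\<^sub>v u) - {0\<^sub>v d} \<and> y \<in> range (\<lambda>c. c \<cdot>\<^sub>v v) - {0\<^sub>v d}}"
  note le1 = unit_scalar_prod_le_one[OF c 1]
  have nz: "s \<cdot>\<^sub>v x \<noteq> 0\<^sub>v d" if "s \<noteq> 0" "x \<in> carrier_vec d" "x \<bullet> x = 1" for s :: real and x
  proof
    assume "s \<cdot>\<^sub>v x = 0\<^sub>v d"
    then have "(s \<cdot>\<^sub>v x) \<bullet> x = 0" using that by simp
    then show False using that by simp
  qed
  have ang: "vec_angle (s \<cdot>\<^sub>v u) (t \<cdot>\<^sub>v v) = arccos (sgn s * sgn t * (u \<bullet> v))" for s t
    using c 1 by (simp add: vec_angle_def vec_norm_def real_sqrt_mult sgn_if)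
  have "Inf ?A = arccos \<bar>u \<bullet> v\<bar>"
  proof (rule cInf_eq_minimum)
    define t where "t = (if u \<bullet> v \<ge> 0 then 1 else -1 :: real)"
    have "vec_angle (1 \<cdot>\<^sub>v u) (t \<cdot>\<^sub>v v) = arccos \<bar>u \<bullet> v\<bar>"
      unfolding ang by (auto simp: t_def)
    moreover have "vec_angle (1 \<cdot>\<^sub>v u) (t \<cdot>\<^sub>v v) \<in> ?A"
    proof -
      have "1 \<cdot>\<^sub>v u \<noteq> 0\<^sub>v d" "t \<cdot>\<^sub>v v \<noteq> 0\<^sub>v d" using nz c 1 by (auto simp: t_def)
      then show ?thesis by blast
    qed
    ultimately show "arccos \<bar>u \<bullet> v\<bar> \<in> ?A" by metis
  next
    fix a assume "a \<in> ?A"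
    then obtain s t where a: "a = arccos (sgn s * sgn t * (u \<bullet> v))" using ang by auto
    have b: "\<bar>sgn s * sgn t * (u \<bullet> v)\<bar> \<le> \<bar>u \<bullet> v\<bar>" by (auto simp: sgn_if)
    show "arccos \<bar>u \<bullet> v\<bar> \<le> a" unfolding a using b le1
      by (intro arccos_le_arccos) auto
  qed
  then show ?thesis by (simp add: line_angle_def)
qed

lemma origin_line_unit_vector:
  assumes "L \<in> origin_lines d"
  shows "\<exists>u \<in> carrier_vec d. u \<bullet> u = 1 \<and> L = range (\<lambda>c. c \<cdot>\<^sub>v u)"
proof -
  obtain v where v: "v \<in> carrier_vec d" "v \<noteq> 0\<^sub>v d" "L = range (\<lambda>c. c \<cdot>\<^sub>v v)"
    using assms by (auto simp: origin_lines_def)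
  define s where "s = sqrt (v \<bullet> v)"
  have s: "s > 0" "v \<bullet> v = s * s" using self_scalar_prod_pos[OF v(1,2)] by (auto simp: s_def)
  have "(1 / s \<cdot>\<^sub>v v) \<bullet> (1 / s \<cdot>\<^sub>v v) = 1"
    using s v by (simp add: field_simps)
  moreover have "L = range (\<lambda>c. c \<cdot>\<^sub>v (1 / s \<cdot>\<^sub>v v))"
  proof -
    have "c \<cdot>\<^sub>v v = (c * s) \<cdot>\<^sub>v (1 / s \<cdot>\<^sub>v v)" for c using s by (simp add: smult_smult_assoc)
    then have "range (\<lambda>c. c \<cdot>\<^sub>v v) \<subseteq> range (\<lambda>c. c \<cdot>\<^sub>v (1 / s \<cdot>\<^sub>v v))" by blast
    moreover have "c \<cdot>\<^sub>v (1 / s \<cdot>\<^sub>v v) = (c / s) \<cdot>\<^sub>v v" for c by (simp add: smult_smult_assoc)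
    then have "range (\<lambda>c. c \<cdot>\<^sub>v (1 / s \<cdot>\<^sub>v v)) \<subseteq> range (\<lambda>c. c \<cdot>\<^sub>v v)" by blast
    ultimately show ?thesis unfolding v(3) by blast
  qed
  ultimately show ?thesis using v(1) by (intro bexI[of _ "1 / s \<cdot>\<^sub>v v"]) auto
qed

lemma equiangular_scalar_prod:
  assumes c: "u \<in> carrier_vec d" "v \<in> carrier_vec d" and 1: "u \<bullet> u = 1" "v \<bullet> v = 1"
    and eq: "line_angle d (range (\<lambda>c. c \<cdot>\<^sub>v u)) (range (\<lambda>c. c \<cdot>\<^sub>v v)) = arccos \<alpha>"
    and \<alpha>: "0 \<le> \<alpha>" "\<alpha> < 1"
  shows "\<bar>u \<bullet> v\<bar> = \<alpha>"
proof -
  have "arccos \<bar>u \<bullet> v\<bar> = arccos \<alpha>" using eq line_angle_unit_vectors[OF c 1] by simp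
  then show ?thesis
    using unit_scalar_prod_le_one[OF c 1] \<alpha> by (subst (asm) arccos_eq_iff) auto
qed

section \<open>Finiteness of equiangular systems\<close>

text \<open>Unit vectors on distinct lines of the system have squared distance at least \<open>2 - 2 * \<alpha>\<close>. So
  rounding their coordinates to multiples of \<open>1 / k\<close> keeps them apart once \<open>k\<close> is large, and there are only
  finitely many rounded vectors with coordinates between \<open>-1\<close> and \<open>1\<close>.\<close>

lemma equiangular_card_bounded:
  assumes \<alpha>: "0 \<le> \<alpha>" "\<alpha> < 1"
  shows "\<exists>B. \<forall>S. finite S \<and> equiangular d (arccos \<alpha>) S \<longrightarrow> card S \<le> B"
proof -
  obtain k :: nat where k: "real k > real d / (2 - 2 * \<alpha>)" using reals_Archimedean2 by blast
  have "0 \<le> real d / (2 - 2 * \<alpha>)" using \<alpha> by simp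
  then have k0: "k > 0" using k by (metis of_nat_0_less_iff order_le_less_trans)
  have kd: "real d < real k * (2 - 2 * \<alpha>)" using k \<alpha> by (simp add: field_simps)
  define F where "F = {xs :: int list. set xs \<subseteq> {- int k..int k} \<and> length xs = d}"
  have finF: "finite F" unfolding F_def by (intro finite_lists_length_eq) auto
  show ?thesis
  proof (intro exI allI impI)
    fix S assume "finite S \<and> equiangular d (arccos \<alpha>) S"
    then have ol: "S \<subseteq> origin_lines d"
      and eq: "\<And>L M. L \<in> S \<Longrightarrow> M \<in> S \<Longrightarrow> L \<noteq> M \<Longrightarrow> line_angle d L M = arccos \<alpha>"
      by (auto simp: equiangular_def)
    have "\<forall>L\<in>S. \<exists>u. u \<in> carrier_vec d \<and> u \<bullet> u = 1 \<and> L = range (\<lambda>c. c \<cdot>\<^sub>v u)"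
      using ol origin_line_unit_vector by blast
    then obtain u where u: "\<And>L. L \<in> S \<Longrightarrow> u L \<in> carrier_vec d" "\<And>L. L \<in> S \<Longrightarrow> u L \<bullet> u L = 1"
      "\<And>L. L \<in> S \<Longrightarrow> L = range (\<lambda>c. c \<cdot>\<^sub>v u L)" by metis
    define f where "f L = map (\<lambda>i. \<lfloor>real k * u L $ i\<rfloor>) [0..<d]" for L
    have "f ` S \<subseteq> F"
    proof (clarsimp simp: F_def f_def)
      fix L i assume L: "L \<in> S" and i: "i < d"
      have "(u L $ i)\<^sup>2 \<le> 1"
        using self_scalar_prod_ge_entry_square[of i "u L"] u[OF L] i by auto
      then have "\<bar>u L $ i\<bar> \<le> 1" by (simp add: abs_square_le_1)
      then have "- real k \<le> real k * u L $ i" "real k * u L $ i \<le> real k"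
        using k0 by (auto simp: abs_le_iff mult_left_le)
           (metis mult_le_cancel_left_pos mult_minus1_right minus_le_iff of_nat_0_less_iff)
      then show "- int k \<le> \<lfloor>real k * u L $ i\<rfloor> \<and> \<lfloor>real k * u L $ i\<rfloor> \<le> int k"
        by linarith
    qed
    moreover have "inj_on f S"
    proof (rule inj_onI, rule ccontr)
      fix L M assume L: "L \<in> S" and M: "M \<in> S" and fLM: "f L = f M" and ne: "L \<noteq> M"
      have ip: "\<bar>u L \<bullet> u M\<bar> = \<alpha>"
        using equiangular_scalar_prod[OF u(1)[OF L] u(1)[OF M] u(2)[OF L] u(2)[OF M] _ \<alpha>]
          eq[OF L M ne] u(3)[OF L] u(3)[OF M] by simp
      have "(u L - u M) \<bullet> (u L - u M) = 2 - 2 * (u L \<bullet> u M)"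
        using u[OF L] u[OF M] comm_scalar_prod[OF u(1)[OF L] u(1)[OF M]]
        by (simp add: minus_scalar_prod_distrib[where n=d] scalar_prod_minus_distrib[where n=d])
      then have far: "(u L - u M) \<bullet> (u L - u M) \<ge> 2 - 2 * \<alpha>" using ip by linarith
      have "(u L - u M) \<bullet> (u L - u M) = (\<Sum>i<d. (u L $ i - u M $ i)\<^sup>2)"
        using u(1)[OF L] u(1)[OF M] unfolding scalar_prod_def
        by (auto simp: power2_eq_square atLeast0LessThan intro!: sum.cong)
      also have "\<dots> \<le> (\<Sum>i<d. (1 / real k)\<^sup>2)"
      proof (intro sum_mono)
        fix i assume "i \<in> {..<d}"
        then have "\<lfloor>real k * u L $ i\<rfloor> = \<lfloor>real k * u M $ i\<rfloor>"
          using fLM by (auto simp: f_def)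
        then have "\<bar>real k * u L $ i - real k * u M $ i\<bar> \<le> 1" by linarith
        then have "real k * \<bar>u L $ i - u M $ i\<bar> \<le> 1"
          using k0 by (simp add: abs_mult flip: right_diff_distrib)
        then have "\<bar>u L $ i - u M $ i\<bar> \<le> 1 / real k" using k0 by (simp add: field_simps)
        then have "\<bar>u L $ i - u M $ i\<bar>\<^sup>2 \<le> (1 / real k)\<^sup>2" by (intro power_mono) auto
        then show "(u L $ i - u M $ i)\<^sup>2 \<le> (1 / real k)\<^sup>2" by simp
      qed
      also have "\<dots> = real d / (real k)\<^sup>2" by (simp add: power_divide)
      also have "\<dots> \<le> real d / real k" using k0 by (intro divide_left_mono) (auto simp: power2_eq_square)
      also have "\<dots> < 2 - 2 * \<alpha>" using kd k0 by (simp add: field_simps)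
      finally show False using far by simp
    qed
    ultimately show "card S \<le> card F" using finF by (metis card_inj_on_le)
  qed
qed

lemma card_le_N:
  assumes "0 \<le> \<alpha>" "\<alpha> < 1" "finite S" "equiangular d (arccos \<alpha>) S"
  shows "card S \<le> N \<alpha> d"
proof -
  let ?C = "{card S |S. finite S \<and> equiangular d (arccos \<alpha>) S}"
  obtain B where "\<And>S. finite S \<Longrightarrow> equiangular d (arccos \<alpha>) S \<Longrightarrow> card S \<le> B"
    using equiangular_card_bounded[OF assms(1,2)] by blast
  then have "?C \<subseteq> {..B}" by auto
  then have "finite ?C" using finite_subset by blast
  then show ?thesis unfolding N_def using assms(3,4) by (intro Max_ge) auto
qed

section \<open>Vectors representing a graph\<close>

text \<open>The Gram matrix is a diagonal matrix \<open>\<nu>\<close> minus the adjacency matrix of some graph on the vertices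
  \<open>0, \<dots>, k - 1\<close>. The graph itself is left implicit, since the scalar products determine it. The diagonal
  varies so that a tree can be grown vertex by vertex, with an unfinished root.\<close>

definition graph_vectors :: "nat \<Rightarrow> nat \<Rightarrow> (nat \<Rightarrow> real) \<Rightarrow> (nat \<Rightarrow> real vec) \<Rightarrow> bool" where
  "graph_vectors k e \<nu> v \<longleftrightarrow>
     (\<forall>i<k. v i \<in> carrier_vec e \<and> v i \<bullet> v i = \<nu> i) \<and>
     (\<forall>i<k. \<forall>j<k. i \<noteq> j \<longrightarrow> v i \<bullet> v j \<in> {0, -1})"

text \<open>A new vertex joined to \<open>\<rho>\<close> alone costs one new coordinate, in which only the new vector and that of
  \<open>\<rho>\<close> are nonzero. This coordinate is the square belonging to the new edge.\<close>

lemma graph_vectors_attach_vertex: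
  assumes v: "graph_vectors k e \<nu> v" and \<rho>: "\<rho> < k" and xy: "x * y = -1"
  shows "\<exists>w. graph_vectors (Suc k) (Suc e) (\<nu>(\<rho> := \<nu> \<rho> + y\<^sup>2, k := x\<^sup>2)) w"
proof -
  define w where "w i = (if i = k then vCons x (0\<^sub>v e) else vCons (if i = \<rho> then y else 0) (v i))" for i
  have vc: "v i \<in> carrier_vec e" if "i < k" for i using v that by (auto simp: graph_vectors_def)
  have "graph_vectors (Suc k) (Suc e) (\<nu>(\<rho> := \<nu> \<rho> + y\<^sup>2, k := x\<^sup>2)) w"
    unfolding graph_vectors_def
  proof (intro conjI allI impI)
    fix i assume "i < Suc k"
    then show "w i \<in> carrier_vec (Suc e)" using vc by (auto simp: w_def)
  next
    fix i assume "i < Suc k"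
    then show "w i \<bullet> w i = (\<nu>(\<rho> := \<nu> \<rho> + y\<^sup>2, k := x\<^sup>2)) i"
      using v \<rho> by (cases "i = k") (auto simp: w_def graph_vectors_def power2_eq_square)
  next
    fix i j assume ij: "i < Suc k" "j < Suc k" "i \<noteq> j"
    consider "i = k" "j < k" | "j = k" "i < k" | "i < k" "j < k" using ij by linarith
    then show "w i \<bullet> w j \<in> {0, -1}"
    proof cases
      case 1 then show ?thesis using vc xy by (auto simp: w_def)
    next
      case 2 then show ?thesis using vc xy by (auto simp: w_def mult.commute)
    next
      case 3 then show ?thesis using v ij by (auto simp: w_def graph_vectors_def)
    qed
  qed
  then show ?thesis by blast
qed

lemma graph_vectors_copies:
  assumes v: "graph_vectors k e (\<lambda>_. x) v"
  shows "\<exists>w. graph_vectors (m * k) (m * e) (\<lambda>_. x) w"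
proof (induction m)
  case 0 show ?case by (simp add: graph_vectors_def)
next
  case (Suc m)
  then obtain w where w: "graph_vectors (m * k) (m * e) (\<lambda>_. x) w" by blast
  define w' where "w' i = (if i < k then v i @\<^sub>v 0\<^sub>v (m * e) else 0\<^sub>v e @\<^sub>v w (i - k))" for i
  have vc: "v i \<in> carrier_vec e" if "i < k" for i using v that by (auto simp: graph_vectors_def)
  have wc: "w (i - k) \<in> carrier_vec (m * e)" if "i < k + m * k" "\<not> i < k" for i
    using w that by (auto simp: graph_vectors_def)
  have ip: "w' i \<bullet> w' j = (if i < k \<and> j < k then v i \<bullet> v j else
      if \<not> i < k \<and> \<not> j < k then w (i - k) \<bullet> w (j - k) else 0)"
    if "i < k + m * k" "j < k + m * k" for i j
    using that vc[of i] vc[of j] wc[of i] wc[of j]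
    by (auto simp: w'_def scalar_prod_append[where ?n1.0=e and ?n2.0="m*e"])
  have "graph_vectors (k + m * k) (e + m * e) (\<lambda>_. x) w'"
    unfolding graph_vectors_def
  proof (intro conjI allI impI)
    fix i assume i: "i < k + m * k"
    show "w' i \<in> carrier_vec (e + m * e)" using vc[of i] wc[of i] i by (auto simp: w'_def)
    show "w' i \<bullet> w' i = x" using i v w by (auto simp: ip graph_vectors_def)
  next
    fix i j assume ij: "i < k + m * k" "j < k + m * k" "i \<noteq> j"
    have "i - k < m * k \<and> j - k < m * k \<and> i - k \<noteq> j - k" if "\<not> i < k" "\<not> j < k"
      using ij that by linarith
    then have "w (i - k) \<bullet> w (j - k) \<in> {0, -1}" if "\<not> i < k" "\<not> j < k"
      using w that unfolding graph_vectors_def by blast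
    then show "w' i \<bullet> w' j \<in> {0, -1}" using ij v by (auto simp: ip graph_vectors_def)
  qed
  then show ?case by auto
qed

text \<open>Adding half the all-ones matrix to \<open>x * I - A\<close> makes the off-diagonal entries \<open>\<plusminus>1/2\<close> and the diagonal
  entries \<open>x + 1/2\<close>, at the price of a single dimension. Scaling by \<open>2 * \<alpha>\<close> normalises the vectors.\<close>

lemma graph_vectors_equiangular:
  assumes w: "graph_vectors K E (\<lambda>_. x) w" and x: "x > 0" and d: "E + 1 \<le> d"
  shows "K \<le> N (1 / (1 + 2 * x)) d"
proof -
  define \<alpha> where "\<alpha> = 1 / (1 + 2 * x)"
  have \<alpha>: "0 < \<alpha>" "\<alpha> < 1" "\<alpha> * (1 + 2 * x) = 1" using x by (auto simp: \<alpha>_def)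
  define f where "f = d - Suc E"
  have d': "d = Suc (E + f)" using d by (simp add: f_def)
  define u where "u i = vCons (sqrt \<alpha>) ((sqrt (2 * \<alpha>) \<cdot>\<^sub>v w i) @\<^sub>v 0\<^sub>v f)" for i
  have wc: "w i \<in> carrier_vec E" if "i < K" for i using w that by (auto simp: graph_vectors_def)
  have uc: "u i \<in> carrier_vec d" if "i < K" for i using wc[OF that] by (auto simp: u_def d')
  have ip: "u i \<bullet> u j = \<alpha> + 2 * \<alpha> * (w i \<bullet> w j)" if "i < K" "j < K" for i j
    using wc[OF that(1)] wc[OF that(2)] \<alpha>(1)
    by (simp add: u_def scalar_prod_append[where ?n1.0=E and ?n2.0=f] mult.assoc[symmetric])
  have u1: "u i \<bullet> u i = 1" if "i < K" for i
    using w that \<alpha>(3) by (auto simp: ip graph_vectors_def algebra_simps)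
  have ua: "\<bar>u i \<bullet> u j\<bar> = \<alpha>" if "i < K" "j < K" "i \<noteq> j" for i j
  proof -
    have "w i \<bullet> w j \<in> {0, -1}" using w that by (auto simp: graph_vectors_def)
    then show ?thesis using that \<alpha>(1) by (auto simp: ip)
  qed
  define l where "l i = range (\<lambda>c. c \<cdot>\<^sub>v u i)" for i
  have ang: "line_angle d (l i) (l j) = arccos \<alpha>" if "i < K" "j < K" "i \<noteq> j" for i j
    unfolding l_def using line_angle_unit_vectors[OF uc uc u1 u1] ua that by simp
  have "inj_on l {..<K}"
  proof (rule inj_onI, rule ccontr)
    fix i j assume ij: "i \<in> {..<K}" "j \<in> {..<K}" and l: "l i = l j" and ne: "i \<noteq> j"
    have "line_angle d (l i) (l i) = arccos 1"
      unfolding l_def using line_angle_unit_vectors[OF uc uc u1 u1, of i i] u1 ij by simp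
    then have "arccos \<alpha> = arccos 1" using ang[of i j] l ij ne by simp
    then show False using \<alpha> by (subst (asm) arccos_eq_iff) auto
  qed
  then have card: "card (l ` {..<K}) = K" by (simp add: card_image)
  have "l i \<in> origin_lines d" if "i < K" for i
  proof -
    have "u i \<noteq> 0\<^sub>v d" using u1[OF that] by auto
    then show ?thesis using uc[OF that] by (auto simp: origin_lines_def l_def)
  qed
  then have "equiangular d (arccos \<alpha>) (l ` {..<K})"
    unfolding equiangular_def using ang by auto
  then show ?thesis using card_le_N[of \<alpha> "l ` {..<K}" d] \<alpha> card by (simp add: \<alpha>_def)
qed

text \<open>Each copy of the graph brings \<open>e + 1\<close> lines for \<open>e\<close> dimensions. The remainder of the division of \<open>d - 1\<close> by
  \<open>e\<close> loses a bounded number of lines, which half of the gain \<open>d / e\<close> absorbs.\<close>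

lemma graph_vectors_linear_gain:
  assumes v: "graph_vectors (Suc e) e (\<lambda>_. x) v" and x: "x > 0" and e: "e > 0"
  shows "\<exists>\<eta> > 0. \<forall>\<^sub>F d in sequentially. real (N (1 / (1 + 2 * x)) d) \<ge> (1 + \<eta>) * real d"
proof (intro exI conjI)
  show "0 < 1 / (2 * real e)" using e by simp
  show "\<forall>\<^sub>F d in sequentially. real (N (1 / (1 + 2 * x)) d) \<ge> (1 + 1 / (2 * real e)) * real d"
  proof (rule eventually_sequentiallyI[of "2 * e * (e + 1)"])
    fix d :: nat assume d: "2 * e * (e + 1) \<le> d"
    define m where "m = (d - 1) div e"
    have "0 < 2 * e * (e + 1)" using e by simp
    then have d1: "d \<ge> 1" using d by linarith
    have "m * e + (d - 1) mod e = d - 1" by (simp add: m_def)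
    moreover have "(d - 1) mod e < e" using e by simp
    ultimately have m: "m * e + 1 \<le> d" "d \<le> m * e + e" using d1 by linarith+
    obtain w where "graph_vectors (m * Suc e) (m * e) (\<lambda>_. x) w"
      using graph_vectors_copies[OF v] by blast
    then have N: "m * Suc e \<le> N (1 / (1 + 2 * x)) d"
      using graph_vectors_equiangular x m(1) by blast
    have "real d \<le> real m * real e + real e" using m(2) by (metis of_nat_add of_nat_mono of_nat_mult)
    then have m': "(real d - real e) / real e \<le> real m" using e by (simp add: field_simps)
    have "real (2 * e * (e + 1)) \<le> real d" using d by (rule of_nat_mono)
    then have d': "real e + 1 \<le> real d / (2 * real e)" using e by (simp add: field_simps)
    have "(1 + 1 / (2 * real e)) * real d = real d + real d / real e - real d / (2 * real e)"
      by (simp add: field_simps)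
    also have "\<dots> \<le> real d + real d / real e - (real e + 1)" using d' by simp
    also have "\<dots> = (real d - real e) / real e * (real e + 1)" using e by (simp add: field_simps)
    also have "\<dots> \<le> real m * (real e + 1)" using m' by (intro mult_right_mono) auto
    also have "\<dots> = real (m * Suc e)" by (simp add: algebra_simps)
    also have "\<dots> \<le> real (N (1 / (1 + 2 * x)) d)" using N by (rule of_nat_mono)
    finally show "(1 + 1 / (2 * real e)) * real d \<le> real (N (1 / (1 + 2 * x)) d)" .
  qed
qed

section \<open>Growing a caterpillar\<close>

text \<open>Of the tree only the count matters: \<open>e + 1\<close> vertices in dimension \<open>e\<close>. Every vertex but the root \<open>\<rho>\<close> has reached its final square norm \<open>x\<close>; the root still lacks
  \<open>r\<close>. For positive \<open>r\<close> this is the ratio of the eigenvector's value at the next vertex to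
  its value at the root. For \<open>r = 0\<close> the tree is complete and has eigenvalue \<open>x\<close>.\<close>

definition rooted_tree :: "real \<Rightarrow> real \<Rightarrow> bool" where
  "rooted_tree x r \<longleftrightarrow> (\<exists>e \<rho> v. \<rho> \<le> e \<and> graph_vectors (Suc e) e ((\<lambda>_. x)(\<rho> := x - r)) v)"

lemma rooted_tree_single: "rooted_tree x x"
  unfolding rooted_tree_def
  by (rule exI[of _ 0], rule exI[of _ 0], rule exI[of _ "\<lambda>_. vNil"]) (auto simp: graph_vectors_def)

text \<open>The new vector must have square norm \<open>x\<close> at once, so its only coordinate is \<open>- sqrt x\<close>; scalar product
  \<open>-1\<close> then forces the contribution \<open>1 / x\<close> at the root.\<close>

lemma rooted_tree_leaf:
  assumes "rooted_tree x r" "x > 0"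
  shows "rooted_tree x (r - 1 / x)"
proof -
  obtain e \<rho> v where \<rho>: "\<rho> \<le> e" and v: "graph_vectors (Suc e) e ((\<lambda>_. x)(\<rho> := x - r)) v"
    using assms(1) by (auto simp: rooted_tree_def)
  have "- sqrt x * (1 / sqrt x) = -1" using assms(2) by simp
  from graph_vectors_attach_vertex[OF v _ this, of \<rho>] \<rho> obtain w where
    w: "graph_vectors (Suc (Suc e)) (Suc e)
      (((\<lambda>_. x)(\<rho> := x - r))(\<rho> := ((\<lambda>_. x)(\<rho> := x - r)) \<rho> + (1 / sqrt x)\<^sup>2, Suc e := (- sqrt x)\<^sup>2)) w"
    by auto
  have "((\<lambda>_. x)(\<rho> := x - r))(\<rho> := ((\<lambda>_. x)(\<rho> := x - r)) \<rho> + (1 / sqrt x)\<^sup>2, Suc e := (- sqrt x)\<^sup>2)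
      = (\<lambda>_. x)(\<rho> := x - (r - 1 / x))"
    using \<rho> assms(2) by (auto simp: fun_eq_iff power_divide)
  then show ?thesis using w \<rho> unfolding rooted_tree_def by (metis le_SucI)
qed

lemma rooted_tree_leaves:
  assumes "rooted_tree x r" "x > 0"
  shows "rooted_tree x (r - real n / x)"
proof (induction n)
  case 0 then show ?case using assms by simp
next
  case (Suc n)
  from rooted_tree_leaf[OF this assms(2)] show ?case by (simp add: diff_divide_distrib add_divide_distrib algebra_simps)
qed

text \<open>The new vertex becomes the root. The old root is completed by the coordinate \<open>sqrt r\<close>, which forces
  square norm \<open>1 / r\<close> on the new one.\<close>

lemma rooted_tree_extend:
  assumes "rooted_tree x r" "r > 0"
  shows "rooted_tree x (x - 1 / r)"
proof -
  obtain e \<rho> v where \<rho>: "\<rho> \<le> e" and v: "graph_vectors (Suc e) e ((\<lambda>_. x)(\<rho> := x - r)) v"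
    using assms(1) by (auto simp: rooted_tree_def)
  have "(- 1 / sqrt r) * sqrt r = -1" using assms(2) by simp
  from graph_vectors_attach_vertex[OF v _ this, of \<rho>] \<rho> obtain w where
    w: "graph_vectors (Suc (Suc e)) (Suc e)
      (((\<lambda>_. x)(\<rho> := x - r))(\<rho> := ((\<lambda>_. x)(\<rho> := x - r)) \<rho> + (sqrt r)\<^sup>2, Suc e := (- 1 / sqrt r)\<^sup>2)) w"
    by auto
  have "((\<lambda>_. x)(\<rho> := x - r))(\<rho> := ((\<lambda>_. x)(\<rho> := x - r)) \<rho> + (sqrt r)\<^sup>2, Suc e := (- 1 / sqrt r)\<^sup>2)
      = (\<lambda>_. x)(Suc e := x - (x - 1 / r))"
    using \<rho> assms(2) by (auto simp: fun_eq_iff power_divide)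
  then show ?thesis using w \<rho> unfolding rooted_tree_def by (metis order_refl)
qed

text \<open>The ratios of an \<open>x\<close>-eigenvector at consecutive path vertices of the caterpillar with \<open>n i\<close> leaves at
  the \<open>i\<close>-th one: a leaf takes \<open>1 / x\<close> times the value of its neighbour.\<close>

primrec spine_ratio :: "(nat \<Rightarrow> nat) \<Rightarrow> nat \<Rightarrow> real \<Rightarrow> real" where
  "spine_ratio n 0 x = x - real (n 0) / x"
| "spine_ratio n (Suc i) x = x - 1 / spine_ratio n i x - real (n (Suc i)) / x"

lemma rooted_tree_caterpillar:
  assumes "x > 0" "\<forall>i<j. spine_ratio n i x > 0"
  shows "rooted_tree x (spine_ratio n j x)"
  using assms(2)
proof (induction j)
  case 0 then show ?case using rooted_tree_leaves[OF rooted_tree_single assms(1)] by simp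
next
  case (Suc j)
  then have "rooted_tree x (x - 1 / spine_ratio n j x)" by (intro rooted_tree_extend) auto
  from rooted_tree_leaves[OF this assms(1)] show ?case by simp
qed

text \<open>A zero ratio says that the path may end at vertex \<open>j\<close>, as the value at the next vertex would be zero.\<close>

lemma caterpillar_linear_gain:
  assumes x: "x > 0" and pos: "\<forall>i<j. spine_ratio n i x > 0" and zero: "spine_ratio n j x = 0"
  shows "\<exists>\<eta> > 0. \<forall>\<^sub>F d in sequentially. real (N (1 / (1 + 2 * x)) d) \<ge> (1 + \<eta>) * real d"
proof -
  have "rooted_tree x 0" using rooted_tree_caterpillar[OF x pos] zero by simp
  then obtain e v where v: "graph_vectors (Suc e) e (\<lambda>_. x) v"
    by (auto simp: rooted_tree_def fun_upd_idem)
  have "e > 0"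
  proof (rule ccontr)
    assume "\<not> e > 0"
    then have "v 0 \<in> carrier_vec 0" "v 0 \<bullet> v 0 = x" using v by (auto simp: graph_vectors_def)
    then show False using x by (auto simp: scalar_prod_def)
  qed
  then show ?thesis using graph_vectors_linear_gain v x by blast
qed

section \<open>Caterpillar eigenvalues are dense\<close>

text \<open>In the coordinate \<open>w t = (t - c) / (K - t)\<close>, shifting both points down by \<open>s\<close> does not decrease
  the quotient \<open>w p / w p'\<close>, provided that the points lie low enough between \<open>c\<close> and \<open>K\<close>: the
  shift matters more for the point closer to \<open>c\<close>.\<close>

lemma cross_ratio_shift:
  fixes c K s p p' :: real
  assumes "c < p'" "p' \<le> p" "0 \<le> s" "p + s < K" and mid: "s = 0 \<or> p + p' + s \<le> K + c"
  shows "(p + s - c) / (K - (p + s)) * ((p' - c) / (K - p'))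
    \<le> (p' + s - c) / (K - (p' + s)) * ((p - c) / (K - p))"
proof -
  \<comment> \<open>The shift by \<open>s\<close> multiplies \<open>(t - c) / (K - t)\<close> by this factor.\<close>
  have factor: "(t + s - c) / (K - (t + s)) = (t - c) / (K - t) * (1 + s * (K - c) / ((K - (t + s)) * (t - c)))"
    if "c < t" "t + s < K" for t
  proof -
    have nz: "K - (t + s) \<noteq> 0" "K - t \<noteq> 0" "t - c \<noteq> 0" using that assms(3) by auto
    have "(t - c) * (K - (t + s)) + s * (K - c) = (t + s - c) * (K - t)" by (simp add: algebra_simps)
    then have "((t - c) * (K - (t + s)) + s * (K - c)) / ((K - t) * (K - (t + s)))
      = (t + s - c) / (K - (t + s))" using nz by simp
    moreover have "(t - c) / (K - t) * (1 + s * (K - c) / ((K - (t + s)) * (t - c)))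
      = ((t - c) * (K - (t + s)) + s * (K - c)) / ((K - t) * (K - (t + s)))"
      using nz by (simp add: divide_simps)
    ultimately show ?thesis by simp
  qed
  have pos: "0 < p' - c" "0 < p - c" "0 < K - p" "0 < K - p'" "0 < K - (p + s)" "0 < K - (p' + s)" "0 \<le> K - c"
    using assms by auto
  have "s * (K - c) / ((K - (p + s)) * (p - c)) \<le> s * (K - c) / ((K - (p' + s)) * (p' - c))"
  proof (cases "s = 0")
    case False
    \<comment> \<open>The quadratic \<open>(K - (t + s)) * (t - c)\<close> increases up to its vertex \<open>(K + c - s) / 2\<close>, and the
      mean of \<open>p\<close> and \<open>p'\<close> lies below that.\<close>
    have "0 \<le> (p - p') * (K + c - (p + p' + s))" using assms mid False by (intro mult_nonneg_nonneg) auto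
    also have "\<dots> = (K - (p + s)) * (p - c) - (K - (p' + s)) * (p' - c)" by (simp add: algebra_simps)
    finally show ?thesis using pos assms(3) by (intro divide_left_mono mult_nonneg_nonneg mult_pos_pos) auto
  qed simp
  then have "(p - c) / (K - p) * ((p' - c) / (K - p')) * (1 + s * (K - c) / ((K - (p + s)) * (p - c)))
    \<le> (p - c) / (K - p) * ((p' - c) / (K - p')) * (1 + s * (K - c) / ((K - (p' + s)) * (p' - c)))"
    using pos by (intro mult_left_mono mult_nonneg_nonneg divide_nonneg_nonneg) auto
  then show ?thesis using factor[of p] factor[of p'] assms by (simp add: mult_ac)
qed

lemma greedy_step:
  fixes b c q :: real
  assumes "b > 0" "c \<le> q"
  shows "\<exists>m::nat. c \<le> q - real m / b \<and> q - real m / b < c + 1 / b"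
proof -
  have "0 \<le> b * (q - c)" using assms by simp
  then have "real (nat \<lfloor>b * (q - c)\<rfloor>) \<le> b * (q - c)" "b * (q - c) < real (nat \<lfloor>b * (q - c)\<rfloor>) + 1"
    by linarith+
  then have "real (nat \<lfloor>b * (q - c)\<rfloor>) / b \<le> q - c" "q - c < real (nat \<lfloor>b * (q - c)\<rfloor>) / b + 1 / b"
    using assms(1) by (simp_all add: pos_divide_le_eq pos_less_divide_eq mult.commute flip: add_divide_distrib)
  then show ?thesis by (intro exI[of _ "nat \<lfloor>b * (q - c)\<rfloor>"]) linarith
qed

text \<open>One more leaf lowers a ratio by \<open>1 / b\<close>, so leaves bring any value \<open>\<ge> c\<close> into the
  interval. Without leaves the next value would again be \<open>\<ge> c\<close>, because \<open>c\<close> is a fixed point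
  of the increasing map \<open>t \<mapsto> b - 1 / t\<close>.\<close>

lemma greedy_caterpillar:
  fixes b c :: real
  assumes c: "0 < c" and b: "b = c + 1 / c"
  shows "\<exists>n. \<forall>i. c \<le> spine_ratio n i b \<and> spine_ratio n i b < c + 1 / b"
proof -
  have b0: "b > 0" using c b by (simp add: add_pos_pos)
  let ?P = "\<lambda>i (my :: nat \<times> real). c \<le> snd my \<and> snd my < c + 1 / b \<and> (i = (0::nat) \<longrightarrow> snd my = b - real (fst my) / b)"
  let ?Q = "\<lambda>(i::nat) my (my' :: nat \<times> real). snd my' = b - 1 / snd my - real (fst my') / b"
  have "\<exists>f. \<forall>i. ?P i (f i) \<and> ?Q i (f i) (f (Suc i))"
  proof (rule dependent_nat_choice)
    have "c \<le> b" using c b by simp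
    from greedy_step[OF b0 this] show "\<exists>my. ?P 0 my" by auto
  next
    fix my i assume P: "?P i my"
    have "1 / snd my \<le> 1 / c" using P c by (intro divide_left_mono) auto
    then have "c \<le> b - 1 / snd my" using b by simp
    from greedy_step[OF b0 this] show "\<exists>my'. ?P (Suc i) my' \<and> ?Q i my my'" by auto
  qed
  then obtain f where f: "\<And>i. ?P i (f i)" "\<And>i. ?Q i (f i) (f (Suc i))" by blast
  have "spine_ratio (fst \<circ> f) i b = snd (f i)" for i
  proof (induction i)
    case 0 show ?case using f(1)[of 0] by simp
  next
    case (Suc i) then show ?case using f(2)[of i] by simp
  qed
  then show ?thesis using f(1) by (intro exI[of _ "fst \<circ> f"]) auto
qed

text \<open>Suppose that all ratios \<open>z i\<close> at \<open>a\<close> are positive, and let \<open>y i\<close> be those at \<open>b\<close>. Then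
  \<open>c < z i < y i < 1 / c\<close>. The quotient \<open>R i = w (y i) / w (z i)\<close> is unchanged by \<open>t \<mapsto> b - 1 / t\<close>, does not
  decrease under the common shift (\<open>cross_ratio_shift\<close>), and grows at least by the factor \<open>1 / g\<close> in each step, since \<open>z\<close>
  falls behind by at least another \<open>b - a\<close>. But \<open>R\<close> is bounded, since \<open>z i\<close> keeps away from \<open>c\<close> (the
  next ratio would otherwise fall below \<open>c\<close>) and \<open>y i\<close> from \<open>1 / c\<close>.\<close>

lemma spine_ratio_not_all_pos:
  fixes a b c :: real
  assumes c: "0 < c" "c ^ 4 + c\<^sup>2 < 1" and b: "b = c + 1 / c" and a: "0 < a" "a < b"
    and y: "\<And>i. c \<le> spine_ratio n i b" "\<And>i. spine_ratio n i b < c + 1 / b"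
  shows "\<exists>i. spine_ratio n i a \<le> 0"
proof (rule ccontr)
  assume "\<not> ?thesis"
  then have z0: "spine_ratio n i a > 0" for i by (simp add: not_le)
  define y where "y i = spine_ratio n i b" for i
  define z where "z i = spine_ratio n i a" for i
  define K where "K = 1 / c"
  define \<epsilon> where "\<epsilon> = b - a"
  define s where "s i = real (n i) / b" for i
  have \<epsilon>: "\<epsilon> > 0" using a by (simp add: \<epsilon>_def)
  have b0: "b > 0" using a by simp
  have cK: "c * K = 1" using c by (simp add: K_def)
  have bK: "b = c + K" by (simp add: b K_def)
  have bc: "b * c = 1 + c\<^sup>2" using cK by (simp add: bK algebra_simps power2_eq_square)
  have K0: "K > 0" using c by (simp add: K_def)
  have yb: "c \<le> y i" "y i < c + 1 / b" for i using y by (auto simp: y_def)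
  have zp: "z i > 0" for i using z0 by (simp add: z_def)
  have s0: "s i \<ge> 0" for i using b0 by (simp add: s_def)
  have ys: "y (Suc i) = b - 1 / y i - s (Suc i)" for i by (simp add: y_def s_def)
  have sa: "s i \<le> real (n i) / a" for i unfolding s_def using a by (intro divide_left_mono) auto
  have zs: "z (Suc i) \<le> b - 1 / z i - s (Suc i) - \<epsilon>" for i
    using sa[of "Suc i"] by (simp add: z_def \<epsilon>_def)
  \<comment> \<open>Below its fixed point \<open>c\<close> the map \<open>t \<mapsto> b - 1 / t\<close> decreases, so a ratio there would become negative.\<close>
  have zc: "c < z i" for i
  proof (rule ccontr)
    assume low: "\<not> c < z i"
    have fall: "z (i + m) \<le> z i - real m * \<epsilon>" for m
    proof (induction m)
      case (Suc m)
      have le: "z (i + m) \<le> c" using Suc low \<epsilon> by (smt (verit) mult_nonneg_nonneg of_nat_0_le_iff)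
      have "c \<le> 1"
      proof (rule ccontr)
        assume "\<not> c \<le> 1"
        then have "1 < c\<^sup>2" by (simp add: one_less_power)
        moreover have "0 \<le> c ^ 4" using c by simp
        ultimately show False using c(2) by linarith
      qed
      then have "c \<le> K" using c by (simp add: K_def field_simps) (metis mult_le_one order_less_imp_le)
      then have "0 \<le> (c - z (i + m)) * (K - z (i + m))" using le by (intro mult_nonneg_nonneg) auto
      then have "b * z (i + m) \<le> 1 + z (i + m) * z (i + m)" using cK by (simp add: bK algebra_simps)
      then have "b \<le> (1 + z (i + m) * z (i + m)) / z (i + m)"
        using zp[of "i + m"] by (simp add: pos_le_divide_eq)
      then have "b - 1 / z (i + m) \<le> z (i + m)"
        using zp[of "i + m"] by (simp add: add_divide_distrib)
      then have "z (i + Suc m) \<le> z (i + m) - \<epsilon>" using zs[of "i + m"] s0[of "Suc (i + m)"] by simp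
      then show ?case using Suc by (simp add: algebra_simps)
    qed simp
    obtain m :: nat where "real m * \<epsilon> > z i" using \<epsilon> reals_Archimedean3 by blast
    then show False using fall[of m] zp[of "i + m"] by simp
  qed
  have zy: "z i < y i" for i
  proof (induction i)
    case 0 show ?case using sa[of 0] \<epsilon> by (simp add: z_def y_def s_def \<epsilon>_def)
  next
    case (Suc i)
    have "1 / y i < 1 / z i" using Suc zp[of i] by (intro divide_strict_left_mono mult_pos_pos) auto
    then show ?case using zs[of i] ys[of i] \<epsilon> by simp
  qed
  have yc: "c < y i" for i using zc zy by (rule less_trans)
  \<comment> \<open>This is again \<open>c ^ 4 + c\<^sup>2 < 1\<close>; strictness keeps \<open>y i\<close> away from \<open>K\<close>.\<close>
  have gap: "c + 1 / b < K"
  proof -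
    have "c\<^sup>2 * (b * c) + c\<^sup>2 < b * c" unfolding bc using c(2) by (simp add: algebra_simps power2_eq_square power4_eq_xxxx)
    then have "c * (c * (c * b + 1)) < c * b" by (simp add: algebra_simps power2_eq_square)
    then have "c * (c * b + 1) < b" using c(1) by simp
    then show ?thesis using b0 c(1) unfolding K_def by (simp add: field_simps)
  qed
  have yK: "y i < K" for i using yb(2)[of i] gap by simp
  have zK: "z i < K" for i using zy yK by (rule less_trans)
  \<comment> \<open>After multiplication by \<open>b\<^sup>2\<close>, and as \<open>b * c = 1 + c\<^sup>2\<close>, this is \<open>c ^ 4 + c\<^sup>2 \<le> 1\<close>. It will put the points to
    be shifted below the vertex of the quadratic in \<open>cross_ratio_shift\<close>.\<close>
  have mid: "(b - 1 / b) * (c + 1 / b) \<le> 2"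
  proof -
    have "(1 + c\<^sup>2) * (1 + c\<^sup>2) \<le> 2 + c\<^sup>2" using c(2) by (simp add: algebra_simps power2_eq_square power4_eq_xxxx)
    then have "b * c * (b * c) \<le> 1 + b * c" unfolding bc by simp
    then have "b * c * (b * c) / (b * b) \<le> (1 + b * c) / (b * b)" using b0 by (intro divide_right_mono) auto
    moreover have "b * c * (b * c) / (b * b) = c\<^sup>2" "(1 + b * c) / (b * b) = 1 / b / b + c / b"
      using b0 by (auto simp: power2_eq_square add_divide_distrib)
    moreover have "(b - 1 / b) * (c + 1 / b) = b * c + 1 - c / b - 1 / b / b"
      using b0 by (simp add: algebra_simps)
    ultimately show ?thesis unfolding bc by linarith
  qed
  define w where "w t = (t - c) / (K - t)" for t
  define R where "R i = w (y i) / w (z i)" for i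
  define g where "g = 1 - \<epsilon> / (K - c)"
  have wpos: "w t > 0" if "c < t" "t < K" for t using that by (simp add: w_def)
  have cKlt: "c < K" using zc zK by (rule less_trans)
  have R0: "R i > 0" for i unfolding R_def using wpos yc yK zc zK by simp
  have wF: "w (b - 1 / t) = K\<^sup>2 * w t" if "c < t" "t < K" for t
  proof -
    have t: "t > 0" "K - t > 0" using that c by auto
    have 1: "b - 1 / t - c = K * (t - c) / t" using t cK by (simp add: bK field_simps)
    have 2: "K - (b - 1 / t) = c * (K - t) / t" using t cK by (simp add: bK field_simps)
    have "w (b - 1 / t) = (K / c) * w t" unfolding w_def 1 2 using t c by simp
    also have "K / c = K\<^sup>2" by (simp add: K_def power2_eq_square)
    finally show ?thesis .
  qed
  have step: "R i \<le> g * R (Suc i) \<and> g > 0" for i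
  proof -
    define p where "p = y (Suc i)"
    define p' where "p' = b - 1 / z i - s (Suc i)"
    have q: "p + s (Suc i) = b - 1 / y i" by (simp add: p_def ys)
    have q': "p' + s (Suc i) = b - 1 / z i" by (simp add: p'_def)
    have zp': "z (Suc i) \<le> p' - \<epsilon>" using zs[of i] by (simp add: p'_def)
    have cp': "c + \<epsilon> < p'" using zp' zc[of "Suc i"] by linarith
    have "1 / y i < 1 / z i" using zy[of i] zp[of i] by (intro divide_strict_left_mono mult_pos_pos) auto
    then have pp: "p' < p" using q q' by linarith
    have pK: "p < K" by (simp add: p_def yK)
    have "1 / K < 1 / y i" using yK[of i] yc[of i] c by (intro divide_strict_left_mono mult_pos_pos) auto
    then have qK: "p + s (Suc i) < K" using q by (simp add: bK K_def)
    have "s (Suc i) = 0 \<or> p + p' + s (Suc i) \<le> K + c"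
    proof (cases "n (Suc i) = 0")
      case False
      have sb: "1 / b \<le> s (Suc i)" unfolding s_def using False b0 by (intro divide_right_mono) auto
      have y0: "0 < y i" using yc[of i] c by simp
      have "b - 1 / b \<le> 2 / y i"
      proof (cases "b - 1 / b \<ge> 0")
        case True
        then have "(b - 1 / b) * y i \<le> (b - 1 / b) * (c + 1 / b)" using yb(2)[of i] by (intro mult_left_mono) auto
        then show ?thesis using mid y0 by (simp add: pos_le_divide_eq)
      next
        case False
        have "0 < 2 / y i" using y0 by simp
        then show ?thesis using False by linarith
      qed
      then have "2 * (b - 1 / y i) \<le> b + s (Suc i)" using sb by (simp add: field_simps)
      then show ?thesis using pp bK unfolding q[symmetric] by simp
    qed (simp add: s_def)
    then have "w (p + s (Suc i)) * w p' \<le> w (p' + s (Suc i)) * w p"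
      unfolding w_def using cross_ratio_shift[of c p' p "s (Suc i)" K] cp' pp \<epsilon> qK s0 by simp
    then have "K\<^sup>2 * (w (y i) * w p') \<le> K\<^sup>2 * (w (z i) * w p)"
      unfolding q q' using wF[OF yc yK, of i] wF[OF zc zK, of i] by (simp add: mult_ac)
    then have 1: "w (y i) * w p' \<le> w (z i) * w p" using K0 by simp
    have p'K: "p' < K" using pp pK by simp
    have "\<epsilon> < K - c" using cp' p'K by linarith
    then have gp: "g > 0" using cKlt by (simp add: g_def)
    have "w (z (Suc i)) \<le> g * w p'"
    proof -
      have "w (z (Suc i)) \<le> (p' - \<epsilon> - c) / (K - p')"
        unfolding w_def using zp' p'K \<epsilon> cp' zc[of "Suc i"] by (intro frac_le) auto
      also have "\<dots> \<le> g * (p' - c) / (K - p')"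
      proof (rule divide_right_mono)
        have "\<epsilon> * (p' - c) \<le> \<epsilon> * (K - c)" using \<epsilon> p'K by simp
        then have "\<epsilon> * (p' - c) / (K - c) \<le> \<epsilon>" using cKlt by (simp add: pos_divide_le_eq)
        then show "p' - \<epsilon> - c \<le> g * (p' - c)" by (simp add: g_def left_diff_distrib)
      qed (use p'K in simp)
      finally show ?thesis by (simp add: w_def)
    qed
    then have "w (y i) * w (z (Suc i)) \<le> w (y i) * (g * w p')"
      using wpos[OF yc yK, of i] by (intro mult_left_mono) auto
    also have "\<dots> \<le> g * (w (z i) * w p)"
      using mult_left_mono[OF 1, of g] gp by (simp add: mult.left_commute)
    finally have "R i \<le> g * R (Suc i)"
      unfolding R_def p_def using wpos[OF zc zK, of i] wpos[OF zc zK, of "Suc i"]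
      by (simp add: field_simps)
    then show ?thesis using gp by simp
  qed
  have g: "0 < g" "g < 1" using step \<epsilon> cKlt by (auto simp: g_def)
  have decay: "R 0 \<le> g ^ i * R i" for i
  proof (induction i)
    case (Suc i)
    have "g ^ i * R i \<le> g ^ i * (g * R (Suc i))" using step g by (intro mult_left_mono) auto
    then show ?case using Suc by (simp add: mult_ac)
  qed simp
  define B where "B = (K - c) / (K - (c + 1 / b)) / (\<epsilon> * c\<^sup>2 / K)"
  have RB: "R i \<le> B" for i
  proof -
    have "w (y i) \<le> (K - c) / (K - (c + 1 / b))"
      unfolding w_def using yb(2)[of i] yK[of i] yc[of i] gap by (intro frac_le) auto
    moreover have "\<epsilon> * c\<^sup>2 / K \<le> w (z i)"
    proof -
      have "c < b - 1 / z i - \<epsilon>" using zc[of "Suc i"] zs[of i] s0[of "Suc i"] by linarith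
      then have "1 / z i < K - \<epsilon>" by (simp add: bK)
      then have "1 < (K - \<epsilon>) * z i" using zp[of i] by (simp add: pos_divide_less_eq)
      then have "c * 1 < c * ((K - \<epsilon>) * z i)" using c(1) by (intro mult_strict_left_mono) auto
      also have "\<dots> = c * K * z i - \<epsilon> * (c * z i)" by (simp add: algebra_simps)
      finally have "\<epsilon> * (c * z i) < z i - c" by (simp add: cK)
      moreover have "\<epsilon> * (c * c) \<le> \<epsilon> * (c * z i)" using \<epsilon> c(1) zc[of i] by simp
      ultimately have "\<epsilon> * c\<^sup>2 \<le> z i - c" by (simp add: power2_eq_square)
      then show ?thesis unfolding w_def using zp[of i] zK[of i] \<epsilon> zc[of i] by (intro frac_le) auto
    qed
    moreover have "0 < \<epsilon> * c\<^sup>2 / K" using \<epsilon> c K0 by simp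
    ultimately show ?thesis unfolding R_def B_def
      using wpos[OF yc yK, of i] by (intro frac_le) auto
  qed
  have "B > 0" using R0[of 0] RB[of 0] by linarith
  obtain i where "g ^ i < R 0 / B" using real_arch_pow_inv[of "R 0 / B" g] g R0[of 0] \<open>B > 0\<close> by auto
  then have "g ^ i * B < R 0" using \<open>B > 0\<close> by (simp add: pos_less_divide_eq)
  moreover have "g ^ i * R i \<le> g ^ i * B" using RB g by (intro mult_left_mono) auto
  ultimately show False using decay[of i] by linarith
qed

lemma continuous_on_spine_ratio:
  assumes "\<And>x. x \<in> A \<Longrightarrow> x \<noteq> 0" "\<And>x i. x \<in> A \<Longrightarrow> i < j \<Longrightarrow> spine_ratio n i x > 0"
  shows "continuous_on A (spine_ratio n j)"
  using assms(2)
proof (induction j)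
  case 0
  have "spine_ratio n 0 = (\<lambda>x. x - real (n 0) / x)" by (simp add: fun_eq_iff)
  then show ?case using assms(1) by (auto intro!: continuous_intros)
next
  case (Suc j)
  then have c: "continuous_on A (spine_ratio n j)" by auto
  have "spine_ratio n j x \<noteq> 0" if "x \<in> A" for x using Suc.prems[of x j] that by auto
  moreover have "spine_ratio n (Suc j) = (\<lambda>x. x - 1 / spine_ratio n j x - real (n (Suc j)) / x)"
    by (simp add: fun_eq_iff)
  ultimately show ?case using assms(1) c by (auto intro!: continuous_intros)
qed

text \<open>At \<open>b = sqrt (2 + sqrt 5)\<close> the square of the smaller fixed point is the inverse of the golden ratio, the
  positive root of \<open>u\<^sup>2 + u = 1\<close>; it decreases as \<open>b\<close> grows.\<close>

lemma small_fixed_point: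
  fixes b :: real
  assumes "b > sqrt (2 + sqrt 5)"
  shows "\<exists>c>0. c ^ 4 + c\<^sup>2 < 1 \<and> b = c + 1 / c"
proof -
  have s5: "sqrt 5 > 2" by (rule real_less_rsqrt) simp
  then have "sqrt (2 + sqrt 5) > 0" by simp
  then have b0: "b > 0" using assms by linarith
  have b2: "b\<^sup>2 > 2 + sqrt 5" using assms b0
    by (metis less_eq_real_def real_sqrt_less_iff real_sqrt_unique)
  define D where "D = sqrt (b\<^sup>2 - 4)"
  have D2: "D\<^sup>2 = b\<^sup>2 - 4" and D0: "D \<ge> 0" using b2 s5 by (auto simp: D_def)
  have Db: "D < b" using D2 D0 b0 by (smt (verit) power_mono)
  define c where "c = (b - D) / 2"
  have c0: "c > 0" using Db by (simp add: c_def)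
  have "c * (b - c) = (b\<^sup>2 - D\<^sup>2) / 4" by (simp add: c_def field_simps power2_eq_square)
  then have prod: "c * (b - c) = 1" using D2 by simp
  then have bc: "b = c + 1 / c" using c0 by (simp add: field_simps)
  define u where "u = c\<^sup>2"
  have u0: "u > 0" using c0 by (simp add: u_def)
  have "c \<le> b - c" using D0 by (simp add: c_def field_simps)
  then have "c * c \<le> c * (b - c)" using c0 by (intro mult_left_mono) auto
  then have u1: "u \<le> 1" using prod by (simp add: u_def power2_eq_square)
  have "b\<^sup>2 * u = (1 + u)\<^sup>2"
  proof -
    have "b * c = 1 + u" using prod by (simp add: u_def power2_eq_square algebra_simps)
    then have "(b * c)\<^sup>2 = (1 + u)\<^sup>2" by simp
    then show ?thesis by (simp add: power_mult_distrib u_def)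
  qed
  then have "(2 + sqrt 5) * u < (1 + u)\<^sup>2" using b2 u0 by (metis mult_strict_right_mono)
  then have q: "0 < u\<^sup>2 - sqrt 5 * u + 1" by (simp add: power2_eq_square algebra_simps)
  \<comment> \<open>The quadratic has the roots \<open>1 / \<phi>\<close> and \<open>\<phi>\<close>, where \<open>\<phi>\<close> is the golden ratio.\<close>
  define h where "h = (sqrt 5 - 1) / 2"
  have s55: "sqrt 5 * sqrt 5 = 5" by simp
  have hq: "h * h + h = 1" by (simp add: h_def field_simps s55)
  have hs: "sqrt 5 = 2 * h + 1" by (simp add: h_def field_simps)
  have "u\<^sup>2 - sqrt 5 * u + 1 = (u - h) * (u - (h + 1))"
    unfolding hs using hq by (simp add: power2_eq_square algebra_simps)
  then have "0 < (u - h) * (u - (h + 1))" using q by simp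
  moreover have "u - (h + 1) < 0" using u1 s5 hs by linarith
  ultimately have uh: "u < h" by (smt (verit) mult_nonneg_nonpos)
  then have "u * u \<le> h * h" using u0 by (intro mult_mono) auto
  then have "u * u + u < 1" using uh hq by linarith
  then have "c ^ 4 + c\<^sup>2 < 1" by (simp add: u_def power2_eq_square power4_eq_xxxx mult.assoc)
  then show ?thesis using c0 bc by blast
qed

text \<open>Take the first \<open>j\<close> for which the \<open>j\<close>-th ratio takes a value \<open>\<le> 0\<close> on the interval. Up to that index the ratios are
  positive, hence the \<open>j\<close>-th one is continuous, and it is positive at \<open>b\<close>.\<close>

lemma dense_linear_gain:
  fixes a b :: real
  assumes a: "0 < a" "a < b" and b: "b > sqrt (2 + sqrt 5)"
  shows "\<exists>x. a \<le> x \<and> x \<le> b \<and>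
    (\<exists>\<eta> > 0. \<forall>\<^sub>F d in sequentially. real (N (1 / (1 + 2 * x)) d) \<ge> (1 + \<eta>) * real d)"
proof -
  obtain c where c: "c > 0" "c ^ 4 + c\<^sup>2 < 1" "b = c + 1 / c" using small_fixed_point[OF b] by blast
  obtain n where n: "\<And>i. c \<le> spine_ratio n i b" "\<And>i. spine_ratio n i b < c + 1 / b"
    using greedy_caterpillar[OF c(1,3)] by blast
  let ?P = "\<lambda>j. \<exists>x\<in>{a..b}. spine_ratio n j x \<le> 0"
  obtain i where "spine_ratio n i a \<le> 0" using spine_ratio_not_all_pos[OF c a n] by blast
  then have "?P i" using a by (intro bexI[of _ a]) auto
  then have "?P (LEAST j. ?P j)" by (rule LeastI)
  moreover have "\<not> ?P i" if "i < (LEAST j. ?P j)" for i using that by (rule not_less_Least)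
  ultimately obtain j where j: "?P j" and least: "\<And>i. i < j \<Longrightarrow> \<not> ?P i" by blast
  then obtain x0 where x0: "x0 \<in> {a..b}" "spine_ratio n j x0 \<le> 0" by blast
  have pos: "spine_ratio n i x > 0" if "i < j" "x \<in> {a..b}" for i x using least[OF that(1)] that(2) not_less by blast
  have "continuous_on {a..b} (spine_ratio n j)" using pos a by (intro continuous_on_spine_ratio) auto
  then have "continuous_on {x0..b} (spine_ratio n j)" by (rule continuous_on_subset) (use x0 in auto)
  moreover have "0 \<le> spine_ratio n j b" using n(1)[of j] c(1) by linarith
  ultimately obtain x where x: "x0 \<le> x" "x \<le> b" "spine_ratio n j x = 0"
    using IVT'[of "spine_ratio n j" x0 0 b] x0 by auto
  then have "x \<in> {a..b}" using x0 by auto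
  moreover from this have "x > 0" using a by auto
  ultimately have "\<exists>\<eta> > 0. \<forall>\<^sub>F d in sequentially. real (N (1 / (1 + 2 * x)) d) \<ge> (1 + \<eta>) * real d"
    using pos x(3) by (intro caterpillar_linear_gain[of x j n]) auto
  then show ?thesis using \<open>x \<in> {a..b}\<close> by (intro exI[of _ x]) simp
qed

section \<open>Common angles approaching the prescribed one\<close>

theorem theorem1p1:
  fixes \<tau> :: real
  assumes "0 < \<tau>" and "\<tau> \<le> 1 / (1 + 2 * sqrt (2 + sqrt 5))"
  shows "\<exists>\<alpha> :: nat \<Rightarrow> real. (\<forall>i. 0 \<le> \<alpha> i \<and> \<alpha> i < 1) \<and> \<alpha> \<longlonglongrightarrow> \<tau> \<and>
    (\<forall>i. \<exists>\<eta> > 0. \<forall>\<^sub>F d in sequentially. real (N (\<alpha> i) d) \<ge> (1 + \<eta>) * real d)"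
proof -
  define l where "l = (1 / \<tau> - 1) / 2"
  have s0: "sqrt (2 + sqrt 5) > 0" by (simp add: add_pos_pos)
  have "1 + 2 * sqrt (2 + sqrt 5) \<le> 1 / \<tau>"
    using assms s0 by (simp add: field_simps)
  then have l: "sqrt (2 + sqrt 5) \<le> l" by (simp add: l_def)
  have l0: "l > 0" using l s0 by linarith
  have "2 * ((r - 1) / 2) = r - 1" for r :: real by simp
  then have "1 + 2 * l = 1 / \<tau>" unfolding l_def by (simp only: add.commute diff_add_cancel)
  then have \<tau>: "\<tau> = 1 / (1 + 2 * l)" by simp
  \<comment> \<open>The density lemma needs a right end above \<open>sqrt (2 + sqrt 5)\<close>, so the approach is from the right;
    this also covers the extreme value of \<open>\<tau>\<close>.\<close>
  have "\<forall>i. \<exists>x. l \<le> x \<and> x \<le> l + 1 / real (Suc i) \<and>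
    (\<exists>\<eta> > 0. \<forall>\<^sub>F d in sequentially. real (N (1 / (1 + 2 * x)) d) \<ge> (1 + \<eta>) * real d)"
    using l l0 by (intro allI dense_linear_gain) (auto intro: le_less_trans)
  then obtain x where x: "\<And>i. l \<le> x i" "\<And>i. x i \<le> l + 1 / real (Suc i)"
    "\<And>i. \<exists>\<eta> > 0. \<forall>\<^sub>F d in sequentially. real (N (1 / (1 + 2 * x i)) d) \<ge> (1 + \<eta>) * real d"
    by metis
  have "(\<lambda>i. l + 1 / real (Suc i)) \<longlonglongrightarrow> l + 0"
    by (intro tendsto_intros) (use lim_inverse_n' LIMSEQ_Suc in blast)
  then have "x \<longlonglongrightarrow> l"
    by (intro tendsto_sandwich[of "\<lambda>_. l" x sequentially "\<lambda>i. l + 1 / real (Suc i)"]) (use x in auto)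
  then have "(\<lambda>i. 1 / (1 + 2 * x i)) \<longlonglongrightarrow> 1 / (1 + 2 * l)"
    using l0 by (intro tendsto_intros) auto
  moreover have "0 \<le> 1 / (1 + 2 * x i) \<and> 1 / (1 + 2 * x i) < 1" for i
  proof -
    have "x i > 0" using x(1)[of i] l s0 by linarith
    then show ?thesis by simp
  qed
  ultimately show ?thesis using x(3) \<tau> by (intro exI[of _ "\<lambda>i. 1 / (1 + 2 * x i)"]) auto
qed

end
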